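(* For $n\ge1$ let $S_n(132)$ be the set of $132$-avoiding permutations of $\{1,\dots,n\}$, and for $\sigma=\sigma_1\cdots\sigma_n$ let $\mathrm{box}(\sigma)$ be the number of indices $i$ such that $|\sigma_i-\sigma_{i+1}|=1$ or $|\sigma_{i-1}-\sigma_i|=1$ (ignoring nonexistent entries). Let $A_n(x)=\sum_{\sigma\in S_n(132)}x^{\mathrm{box}(\sigma)}$, $B_n(x)=\sum_{\sigma\in S_n(132),\sigma_1=n}x^{\mathrm{box}(\sigma)}$, $E_n(x)=\sum_{\sigma\in S_n(132),\sigma_n=n}x^{\mathrm{box}(\sigma)}$. Then for $n\ge2$ the constant terms of $A_n(x)$, $B_n(x)$ and $E_n(x)$ are all $0$.
   Context: A permutation $\sigma\in S_n$ avoids $132$ if there are no indices $i<j<k$ with $\sigma_i<\sigma_k<\sigma_j$. *)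

theory Defs
  imports "HOL-Combinatorics.Permutations" "HOL-Computational_Algebra.Polynomial"
begin

text \<open>
  A permutation \<open>\<sigma>\<close> of \<open>{1..n}\<close> is a function with \<open>\<sigma> permutes {1..n}\<close>; its one-line notation
  is \<open>\<sigma> 1, \<dots>, \<sigma> n\<close>. Outside \<open>{1..n}\<close> such a function is the identity, so every index condition
  below is restricted to \<open>{1..n}\<close>.
\<close>

definition avoids_132 :: "nat \<Rightarrow> (nat \<Rightarrow> nat) \<Rightarrow> bool" where
  "avoids_132 n \<sigma> \<longleftrightarrow>
     \<not> (\<exists>i\<in>{1..n}. \<exists>j\<in>{1..n}. \<exists>k\<in>{1..n}. i < j \<and> j < k \<and> \<sigma> i < \<sigma> k \<and> \<sigma> k < \<sigma> j)"

definition S132 :: "nat \<Rightarrow> (nat \<Rightarrow> nat) set" where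
  "S132 n = {\<sigma>. \<sigma> permutes {1..n} \<and> avoids_132 n \<sigma>}"

definition box :: "nat \<Rightarrow> (nat \<Rightarrow> nat) \<Rightarrow> nat" where
  "box n \<sigma> = card {i \<in> {1..n}.
     (i + 1 \<in> {1..n} \<and> \<bar>int (\<sigma> i) - int (\<sigma> (i + 1))\<bar> = 1) \<or>
     (i - 1 \<in> {1..n} \<and> \<bar>int (\<sigma> (i - 1)) - int (\<sigma> i)\<bar> = 1)}"

definition A :: "nat \<Rightarrow> int poly" where
  "A n = (\<Sum>\<sigma>\<in>S132 n. monom 1 (box n \<sigma>))"

definition B :: "nat \<Rightarrow> int poly" where
  "B n = (\<Sum>\<sigma>\<in>{\<sigma> \<in> S132 n. \<sigma> 1 = n}. monom 1 (box n \<sigma>))"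

definition E :: "nat \<Rightarrow> int poly" where
  "E n = (\<Sum>\<sigma>\<in>{\<sigma> \<in> S132 n. \<sigma> n = n}. monom 1 (box n \<sigma>))"

end

theory Submission
  imports Defs
begin

text \<open>
  It suffices that every 132-avoiding permutation of length at least 2 has two neighbouring
  entries that differ by 1. Let \<open>k\<close> be the first ascent (or \<open>n\<close> if there is none). The value
  \<open>\<sigma> k + 1\<close> cannot occur after position \<open>k + 1\<close>, as it would be the 2 in a pattern 132 that
  starts with \<open>\<sigma> k, \<sigma> (k + 1)\<close>. If it occurs before position \<open>k\<close>, then it occurs at \<open>k - 1\<close>,
  since the entries up to \<open>k\<close> are decreasing.
\<close>

lemma avoids_132_adjacent:
  assumes perm: "\<sigma> permutes {1..n}" and avoids: "avoids_132 n \<sigma>" and n: "n \<ge> 2"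
  obtains i where "i \<in> {1..<n}" "\<bar>int (\<sigma> i) - int (\<sigma> (i + 1))\<bar> = 1"
proof -
  have range: "\<sigma> i \<in> {1..n}" if "i \<in> {1..n}" for i
    using permutes_in_image[OF perm] that by blast
  have inj: "inj \<sigma>" using perm by (rule permutes_inj)
  define P where "P k \<longleftrightarrow> 1 \<le> k \<and> (k = n \<or> \<sigma> k < \<sigma> (k + 1))" for k
  define k where "k = (LEAST k. P k)"
  have "P n" using n by (simp add: P_def)
  then have Pk: "P k" and kn: "k \<le> n"
    unfolding k_def by (auto intro: LeastI Least_le)
  have k1: "1 \<le> k" using Pk by (simp add: P_def)
  have desc: "\<sigma> (i + 1) < \<sigma> i" if "1 \<le> i" "i < k" for i
  proof -
    have "\<not> P i" using that not_less_Least unfolding k_def by blast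
    moreover have "\<sigma> (i + 1) \<noteq> \<sigma> i" using inj by (auto dest: injD)
    ultimately show ?thesis using that by (auto simp: P_def)
  qed
  have decreasing: "\<sigma> j \<le> \<sigma> i" if "i \<le> j" "1 \<le> i" "j \<le> k" for i j
    using that
  proof (induction j rule: dec_induct)
    case (step m)
    then show ?case using desc[of m] by simp
  qed simp
  \<comment> \<open>This keeps \<open>\<sigma> k + 1\<close> within \<open>{1..n}\<close>, so that
    some position takes this value. If \<open>k = n\<close>, the larger entry comes just before, and
    \<open>n \<ge> 2\<close> provides it.\<close>
  have "\<sigma> k < n"
  proof (cases "k = n")
    case True
    then have "\<sigma> n < \<sigma> (n - 1)" using desc[of "n - 1"] n by simp
    moreover have "\<sigma> (n - 1) \<le> n" using range[of "n - 1"] n by simp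
    ultimately show ?thesis using True by simp
  next
    case False
    then show ?thesis using Pk range[of "k + 1"] kn by (simp add: P_def)
  qed
  then have "\<sigma> k + 1 \<in> \<sigma> ` {1..n}" using permutes_image[OF perm] by simp
  then obtain p where p: "p \<in> {1..n}" "\<sigma> p = \<sigma> k + 1" by force
  then have "p \<noteq> k" by auto
  then consider "p < k" | "p = k + 1" | "p > k + 1" by linarith
  then show ?thesis
  proof cases
    case 1
    \<comment> \<open>As \<open>p \<le> k - 1\<close>, these bounds squeeze
      \<open>\<sigma> (k - 1)\<close> to \<open>\<sigma> k + 1\<close>.\<close>
    then have "\<sigma> (k - 1) \<le> \<sigma> k + 1" "\<sigma> k < \<sigma> (k - 1)"
      using decreasing[of p "k - 1"] desc[of "k - 1"] p by auto
    moreover have "k - 1 \<in> {1..<n}" "k - 1 + 1 = k" using 1 p kn by auto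
    ultimately show ?thesis using that[of "k - 1"] by simp
  next
    case 2
    then show ?thesis using that[of k] p k1 by simp
  next
    case 3
    \<comment> \<open>Here \<open>k + 1 < p \<le> n\<close> rules out \<open>k = n\<close>.\<close>
    then have "\<sigma> k < \<sigma> (k + 1)" using Pk p by (simp add: P_def)
    moreover have "\<sigma> (k + 1) \<noteq> \<sigma> p" using inj 3 by (auto dest: injD)
    \<comment> \<open>No value lies strictly between \<open>\<sigma> k\<close> and
      \<open>\<sigma> p\<close>, so \<open>\<sigma> (k + 1)\<close> must exceed
      \<open>\<sigma> p\<close>.\<close>
    ultimately have "\<sigma> k < \<sigma> p \<and> \<sigma> p < \<sigma> (k + 1)" using p by simp
    moreover have "k \<in> {1..n}" "k + 1 \<in> {1..n}" using 3 p k1 by auto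
    moreover have "k < k + 1" by simp
    ultimately have False
      using avoids 3 p(1) unfolding avoids_132_def by blast
    then show ?thesis ..
  qed
qed

lemma box_pos:
  assumes "\<sigma> \<in> S132 n" and "n \<ge> 2"
  shows "box n \<sigma> > 0"
proof -
  obtain i where "i \<in> {1..<n}" "\<bar>int (\<sigma> i) - int (\<sigma> (i + 1))\<bar> = 1"
    using assms avoids_132_adjacent[of \<sigma> n] by (auto simp: S132_def)
  moreover from this have "i \<in> {1..n}" "i + 1 \<in> {1..n}" by auto
  ultimately have "{i \<in> {1..n}.
     (i + 1 \<in> {1..n} \<and> \<bar>int (\<sigma> i) - int (\<sigma> (i + 1))\<bar> = 1) \<or>
     (i - 1 \<in> {1..n} \<and> \<bar>int (\<sigma> (i - 1)) - int (\<sigma> i)\<bar> = 1)} \<noteq> {}"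
    by blast
  then show ?thesis
    unfolding box_def card_gt_0_iff by (intro conjI finite_Collect_conjI disjI1) simp_all
qed

text \<open>Every monomial has positive degree by \<open>box_pos\<close>. The arbitrary subset
  \<open>X\<close> lets one statement serve \<open>A\<close>, \<open>B\<close> and
  \<open>E\<close>.\<close>

lemma coeff_0_sum_monom_box:
  assumes "X \<subseteq> S132 n" and "n \<ge> 2"
  shows "coeff (\<Sum>\<sigma>\<in>X. monom (1 :: int) (box n \<sigma>)) 0 = 0"
proof -
  have "coeff (monom (1 :: int) (box n \<sigma>)) 0 = 0" if "\<sigma> \<in> X" for \<sigma>
    using box_pos[of \<sigma> n] assms that by auto
  then show ?thesis by (simp add: coeff_sum)
qed

theorem theorem2:
  fixes n :: nat
  assumes "n \<ge> 2"
  shows "coeff (A n) 0 = 0 \<and> coeff (B n) 0 = 0 \<and> coeff (E n) 0 = 0"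
  unfolding A_def B_def E_def using assms by (intro conjI coeff_0_sum_monom_box) auto

end
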